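(* Let $k\ge3$, let $\mathcal{H}$ be a connected $k$-uniform hypergraph on vertex set $[n]$, and let $b_i>0$ for each $i\in[n]$. For $i\in[n]$ put $$b'_i=b_i^{-(k-1)}\sum_{e\in E(\mathcal{H}),\, i\in e}\ \prod_{v\in e\setminus\{i\}} b_v ,\qquad g(i,j)=\frac{d_i+d_j+\sqrt{(d_i-d_j)^2+4b'_ib'_j}}{2}.$$ Then $$\min_{e\in E(\mathcal{H})}\min_{\{i,j\}\subseteq e}g(i,j)\le\rho(\mathbb{Q}(\mathcal{H}))\le\max_{e\in E(\mathcal{H})}\max_{\{i,j\}\subseteq e}g(i,j).$$ Moreover, one of these equalities holds if and only if $d_i+b'_i=d_j+b'_j$ for all $i,j\in[n]$.
   Context: A $k$-uniform hypergraph $\mathcal{H}$ has vertex set $[n]$ and edge set $E(\mathcal{H})$ of $k$-element subsets of $[n]$; $d_i$ is the number of edges containing vertex $i$. It is connected if any two vertices are joined by a walk $v_0,e_1,v_1,\ldots,e_\ell,v_\ell$ with $\{v_i,v_{i+1}\}\subseteq e_{i+1}$. The adjacency tensor $\mathbb{A}(\mathcal{H})$ is the order $k$ dimension $n$ tensor with entry $\frac{1}{(k-1)!}$ at $(i_1,\ldots,i_k)$ if $\{i_1,\ldots,i_k\}\in E(\mathcal{H})$ and $0$ otherwise. The signless Laplacian tensor is $\mathbb{Q}(\mathcal{H})=\mathbb{D}(\mathcal{H})+\mathbb{A}(\mathcal{H})$, where $\mathbb{D}(\mathcal{H})$ is the order $k$ dimension $n$ diagonal tensor with entry $d_i$ at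 $(i,\ldots,i)$. For an order $k$ dimension $n$ tensor $\mathbb{T}$, $\lambda\in\mathbb{C}$ is an eigenvalue if there is nonzero $X\in\mathbb{C}^n$ with $\sum_{i_2,\ldots,i_k}t_{ii_2\ldots i_k}x_{i_2}\cdots x_{i_k}=\lambda x_i^{k-1}$ for all $i$; $\rho(\mathbb{T})$ is the maximum modulus of eigenvalues. *)

theory Defs
  imports Complex_Main
begin

definition uniform_hypergraph :: "nat \<Rightarrow> nat \<Rightarrow> nat set set \<Rightarrow> bool" where
  "uniform_hypergraph k n E \<longleftrightarrow> (\<forall>e\<in>E. e \<subseteq> {1..n} \<and> card e = k)"

definition vertex_degree :: "nat set set \<Rightarrow> nat \<Rightarrow> nat" where
  "vertex_degree E i = card {e \<in> E. i \<in> e}"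

text \<open>The walk \<open>v\<^sub>0, e\<^sub>1, v\<^sub>1, \<dots>, e\<^sub>l, v\<^sub>l\<close> is given by its list \<open>vs\<close> of \<open>l + 1\<close> vertices and its
  list \<open>es\<close> of \<open>l\<close> edges, so that \<open>es ! m\<close> is \<open>e\<^sub>m\<^sub>+\<^sub>1\<close>.\<close>

definition is_walk :: "nat \<Rightarrow> nat set set \<Rightarrow> nat list \<Rightarrow> nat set list \<Rightarrow> bool" where
  "is_walk n E vs es \<longleftrightarrow>
     length vs = length es + 1 \<and> set vs \<subseteq> {1..n} \<and> set es \<subseteq> E \<and>
     (\<forall>m<length es. {vs ! m, vs ! (m + 1)} \<subseteq> es ! m)"

definition connected_hypergraph :: "nat \<Rightarrow> nat set set \<Rightarrow> bool" where
  "connected_hypergraph n E \<longleftrightarrow>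
     (\<forall>u\<in>{1..n}. \<forall>v\<in>{1..n}. \<exists>vs es. is_walk n E vs es \<and> hd vs = u \<and> last vs = v)"

text \<open>A tensor of order \<open>k\<close> and dimension \<open>n\<close> is a function on index lists; only its values on
  lists of length \<open>k\<close> over \<open>{1..n}\<close> matter. Likewise only the coordinates in \<open>{1..n}\<close> of a vector
  of dimension \<open>n\<close> matter.\<close>

type_synonym tensor = "nat list \<Rightarrow> complex"

definition adjacency_tensor :: "nat \<Rightarrow> nat set set \<Rightarrow> tensor" where
  "adjacency_tensor k E = (\<lambda>is. if set is \<in> E then 1 / fact (k - 1) else 0)"

definition degree_tensor :: "nat \<Rightarrow> nat set set \<Rightarrow> tensor" where
  "degree_tensor k E = (\<lambda>is. if is = replicate k (hd is) then of_nat (vertex_degree E (hd is)) else 0)"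

definition signless_laplacian_tensor :: "nat \<Rightarrow> nat set set \<Rightarrow> tensor" where
  "signless_laplacian_tensor k E = (\<lambda>is. degree_tensor k E is + adjacency_tensor k E is)"

definition tensor_eigenvalue :: "nat \<Rightarrow> nat \<Rightarrow> tensor \<Rightarrow> complex \<Rightarrow> bool" where
  "tensor_eigenvalue k n T lam \<longleftrightarrow>
     (\<exists>x :: nat \<Rightarrow> complex. (\<exists>i\<in>{1..n}. x i \<noteq> 0) \<and>
       (\<forall>i\<in>{1..n}.
         (\<Sum>js | length js = k - 1 \<and> set js \<subseteq> {1..n}. T (i # js) * (\<Prod>j\<leftarrow>js. x j))
           = lam * x i ^ (k - 1)))"

text \<open>\<open>GREATEST\<close> rather than \<open>Max\<close>, since \<open>Max\<close> is unspecified unless the set of moduli is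
  already known to be finite.\<close>

definition tensor_spectral_radius :: "nat \<Rightarrow> nat \<Rightarrow> tensor \<Rightarrow> real" where
  "tensor_spectral_radius k n T = (GREATEST r. \<exists>lam. tensor_eigenvalue k n T lam \<and> r = cmod lam)"

definition b_prime :: "nat \<Rightarrow> nat set set \<Rightarrow> (nat \<Rightarrow> real) \<Rightarrow> nat \<Rightarrow> real" where
  "b_prime k E b i = (\<Sum>e | e \<in> E \<and> i \<in> e. \<Prod>v\<in>e - {i}. b v) / b i ^ (k - 1)"

definition g_pair :: "nat \<Rightarrow> nat set set \<Rightarrow> (nat \<Rightarrow> real) \<Rightarrow> nat \<Rightarrow> nat \<Rightarrow> real" where
  "g_pair k E b i j =
     (real (vertex_degree E i) + real (vertex_degree E j)
       + sqrt ((real (vertex_degree E i) - real (vertex_degree E j))\<^sup>2 + 4 * b_prime k E b i * b_prime k E b j)) / 2"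

definition vertex_pairs :: "nat set \<Rightarrow> (nat \<times> nat) set" where
  "vertex_pairs e = {(i, j). i \<noteq> j \<and> {i, j} \<subseteq> e}"

end

theory Submission
  imports Defs "HOL-Analysis.Function_Topology" "HOL-Combinatorics.Multiset_Permutations"
begin

text \<open>A maximiser \<open>x\<close> of the form \<open>\<Sum>\<^sub>i d\<^sub>i x\<^sub>i\<^bsup>k\<^esup> + k \<Sum>\<^sub>e \<Prod>\<^sub>v\<^sub>\<in>\<^sub>e x\<^sub>v\<close> over the vectors \<open>x \<ge> 0\<close> with
  \<open>\<Sum>\<^sub>i x\<^sub>i\<^bsup>k\<^esup> = 1\<close> is positive, and its stationarity says \<open>d\<^sub>i + b'\<^sub>i(x) = r\<close> for all \<open>i\<close>, where \<open>r\<close>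
  is the maximum; hence \<open>r = \<rho>(Q)\<close>. Since \<open>r - d\<^sub>i = b'\<^sub>i(x)\<close>, the inequality \<open>r \<le> g(i,j)\<close> is
  equivalent to \<open>b'\<^sub>i(x) b'\<^sub>j(x) \<le> b'\<^sub>i(b) b'\<^sub>j(b)\<close>. This is a statement about two positive vectors \<open>x\<close>
  and \<open>b\<close>, and the lower bound is the same statement with \<open>x\<close> and \<open>b\<close> exchanged.

  For the upper bound let \<open>i\<close> maximise \<open>y = x / b\<close> and let \<open>j\<close> maximise \<open>y\<close> among the neighbours
  of \<open>i\<close>. Then \<open>b'\<^sub>i(x) y\<^sub>i\<^bsup>k-1\<^esup> \<le> b'\<^sub>i(b) y\<^sub>j\<^bsup>k-1\<^esup>\<close> and \<open>b'\<^sub>j(x) y\<^sub>j\<^bsup>k-1\<^esup> \<le> b'\<^sub>j(b) y\<^sub>i\<^bsup>k-1\<^esup>\<close>; multiply. If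
  equality holds, then \<open>y\<close> is \<open>y\<^sub>j\<close> at all neighbours of \<open>i\<close> and \<open>y\<^sub>i\<close> at all neighbours of \<open>j\<close>. As
  \<open>k \<ge> 3\<close>, the vertices \<open>i\<close> and \<open>j\<close> have a common neighbour, so \<open>y\<^sub>i = y\<^sub>j\<close>, and connectedness makes
  \<open>y\<close> constant.\<close>

subsection \<open>Maxima, roots and homogeneous functions\<close>

lemma (in semilattice_set) UN:
  assumes "finite A" "A \<noteq> {}" "\<And>a. a \<in> A \<Longrightarrow> finite (B a)" "\<And>a. a \<in> A \<Longrightarrow> B a \<noteq> {}"
  shows "F (\<Union>a\<in>A. B a) = F ((\<lambda>a. F (B a)) ` A)"
  using assms by (induction A rule: finite_ne_induct) (simp_all add: union)

lemma ex_arg_max: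
  fixes f :: "'a \<Rightarrow> 'b::linorder"
  assumes "finite A" "A \<noteq> {}"
  shows "\<exists>a\<in>A. \<forall>v\<in>A. f v \<le> f a"
  using obtains_MAX[OF assms, of f] assms(1) by (metis Max_ge finite_imageI imageI)

lemma prod_mono_inv:
  fixes f g :: "'a \<Rightarrow> 'b::linordered_semidom"
  assumes "prod f A = prod g A" "\<And>v. v \<in> A \<Longrightarrow> 0 < f v \<and> f v \<le> g v" "a \<in> A" "finite A"
  shows "f a = g a"
proof (rule ccontr)
  assume "f a \<noteq> g a"
  with assms(2,3) have "f a < g a" by (simp add: order.strict_iff_order)
  with assms(2-4) have "prod f A < prod g A"
    by (intro prod_mono_strict[of a]) (auto intro: less_imp_le less_le_trans)
  with assms(1) show False by simp
qed

lemma sum_fun_upd: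
  fixes f :: "'a \<Rightarrow> 'b \<Rightarrow> 'c::ab_group_add"
  assumes "finite A" "i \<in> A"
  shows "(\<Sum>v\<in>A. f v ((x(i := t)) v)) = (\<Sum>v\<in>A. f v (x v)) + (f i t - f i (x i))"
proof -
  have "(\<Sum>v\<in>A - {i}. f v ((x(i := t)) v)) = (\<Sum>v\<in>A - {i}. f v (x v))"
    by (rule sum.cong) auto
  then show ?thesis by (simp add: sum.remove[OF assms])
qed

definition nonneg_power_sphere :: "'a set \<Rightarrow> nat \<Rightarrow> ('a \<Rightarrow> real) set" where
  "nonneg_power_sphere I k =
     {x. (\<forall>i\<in>I. 0 \<le> x i) \<and> (\<forall>i. i \<notin> I \<longrightarrow> x i = 0) \<and> (\<Sum>i\<in>I. x i ^ k) = 1}"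

lemma compact_nonneg_power_sphere:
  assumes "finite I" "0 < k"
  shows "compact (nonneg_power_sphere I k)"
proof -
  define K where "K = (\<Pi>\<^sub>E i\<in>UNIV. if i \<in> I then {0..1} else {0::real})"
  define S where "S = {x :: 'a \<Rightarrow> real. (\<Sum>i\<in>I. x i ^ k) = 1}"
  have "compactin (product_topology (\<lambda>i. euclidean) UNIV) K"
    unfolding K_def by (subst compactin_PiE) auto
  then have "compact K" by (simp add: euclidean_product_topology)
  moreover have "closed S"
    unfolding S_def by (intro closed_Collect_eq continuous_intros continuous_on_product_coordinates)
  ultimately have "compact (K \<inter> S)" by (rule compact_Int_closed)
  moreover have "x i \<le> 1" if "\<forall>i\<in>I. 0 \<le> x i" "x \<in> S" "i \<in> I" for x i
  proof -
    have "x i ^ k \<le> 1 ^ k"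
      using member_le_sum[of i I "\<lambda>i. x i ^ k"] that assms(1) by (simp add: S_def)
    then show ?thesis using that(1,3) \<open>0 < k\<close> by (simp add: power_le_one_iff)
  qed
  then have "K \<inter> S = nonneg_power_sphere I k"
    by (auto simp: nonneg_power_sphere_def K_def S_def PiE_iff split: if_splits)
  ultimately show ?thesis by simp
qed

lemma homogeneous_le_power_sum:
  fixes f :: "('a \<Rightarrow> real) \<Rightarrow> real"
  assumes "finite I" "0 < k"
    and hom: "\<And>t x. f (\<lambda>i. t * x i) = t ^ k * f x"
    and cong: "\<And>x z. (\<And>i. i \<in> I \<Longrightarrow> x i = z i) \<Longrightarrow> f x = f z"
    and sphere: "\<And>x. (\<And>i. i \<in> I \<Longrightarrow> 0 \<le> x i) \<Longrightarrow> (\<Sum>i\<in>I. x i ^ k) = 1 \<Longrightarrow> f x \<le> M"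
    and nonneg: "\<And>i. i \<in> I \<Longrightarrow> 0 \<le> z i"
  shows "f z \<le> M * (\<Sum>i\<in>I. z i ^ k)"
proof -
  define N where "N = (\<Sum>i\<in>I. z i ^ k)"
  have "0 \<le> N" unfolding N_def by (intro sum_nonneg) (simp add: nonneg)
  then consider (zero) "N = 0" | (pos) "0 < N" by linarith
  then show ?thesis
  proof cases
    case zero
    then have "z i = 0" if "i \<in> I" for i
      using sum_nonneg_eq_0_iff[of I "\<lambda>i. z i ^ k"] nonneg that \<open>finite I\<close> by (simp add: N_def)
    then have "f z = f (\<lambda>i. 0 * z i)" by (intro cong) simp
    then show ?thesis using hom[of 0 z] \<open>0 < k\<close> zero by (simp add: N_def zero_power)
  next
    case pos
    define t where "t = inverse (root k N)"
    have t: "0 < t" "t ^ k = inverse N" using pos \<open>0 < k\<close> by (simp_all add: t_def power_inverse)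
    have "(\<Sum>i\<in>I. (t * z i) ^ k) = inverse N * N"
      by (simp add: N_def sum_distrib_left power_mult_distrib t(2))
    then have "f (\<lambda>i. t * z i) \<le> M"
      using pos t(1) nonneg by (intro sphere) auto
    then have "inverse N * f z \<le> M" by (simp add: hom t(2))
    then show ?thesis using pos by (simp add: N_def[symmetric] field_simps)
  qed
qed

lemma homogeneous_maximiser:
  fixes f :: "('a \<Rightarrow> real) \<Rightarrow> real"
  assumes "finite I" "I \<noteq> {}" "0 < k" and cont: "continuous_on UNIV f"
    and hom: "\<And>t x. f (\<lambda>i. t * x i) = t ^ k * f x"
    and cong: "\<And>x z. (\<And>i. i \<in> I \<Longrightarrow> x i = z i) \<Longrightarrow> f x = f z"
  obtains x where "\<And>i. i \<in> I \<Longrightarrow> 0 \<le> x i" "(\<Sum>i\<in>I. x i ^ k) = 1"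
    "\<And>z. (\<And>i. i \<in> I \<Longrightarrow> 0 \<le> z i) \<Longrightarrow> f z \<le> f x * (\<Sum>i\<in>I. z i ^ k)"
proof -
  let ?K = "nonneg_power_sphere I k"
  obtain i where i: "i \<in> I" using \<open>I \<noteq> {}\<close> by blast
  have "(\<Sum>j\<in>I. (if j = i then 1 else 0 :: real) ^ k) = (\<Sum>j\<in>I. if j = i then 1 else 0)"
    using \<open>0 < k\<close> by (intro sum.cong) auto
  then have "(\<lambda>j. if j = i then 1 else 0) \<in> ?K"
    using i \<open>finite I\<close> by (auto simp: nonneg_power_sphere_def)
  moreover have "compact ?K"
    by (rule compact_nonneg_power_sphere) fact+
  ultimately obtain x where x: "x \<in> ?K" and max: "\<And>w. w \<in> ?K \<Longrightarrow> f w \<le> f x"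
    using continuous_attains_sup[of ?K f] continuous_on_subset[OF cont] by blast
  have sphere: "f w \<le> f x" if "\<And>i. i \<in> I \<Longrightarrow> 0 \<le> w i" "(\<Sum>i\<in>I. w i ^ k) = 1" for w
  proof -
    have "f w = f (\<lambda>i. if i \<in> I then w i else 0)" by (rule cong) simp
    also have "\<dots> \<le> f x" using that by (intro max) (simp add: nonneg_power_sphere_def)
    finally show ?thesis .
  qed
  show ?thesis
  proof (rule that)
    show "f z \<le> f x * (\<Sum>i\<in>I. z i ^ k)" if "\<And>i. i \<in> I \<Longrightarrow> 0 \<le> z i" for z
      by (rule homogeneous_le_power_sum[OF \<open>finite I\<close> \<open>0 < k\<close> hom cong sphere that])
  qed (use x in \<open>auto simp: nonneg_power_sphere_def\<close>)
qed

lemma le_mult_small_imp_nonpos: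
  fixes a c :: real
  assumes "\<And>\<epsilon>. 0 < \<epsilon> \<Longrightarrow> \<epsilon> \<le> 1 \<Longrightarrow> a \<le> c * \<epsilon>"
  shows "a \<le> 0"
proof (rule tendsto_lowerbound)
  show "((\<lambda>\<epsilon>. c * \<epsilon>) \<longlongrightarrow> 0) (at_right 0)" by (intro tendsto_eq_intros) auto
  show "\<forall>\<^sub>F \<epsilon> in at_right 0. a \<le> c * \<epsilon>"
    unfolding eventually_at_right_field using assms by (intro exI[of _ 1]) auto
qed simp

lemma
  fixes r a c p :: real
  assumes "a \<le> r" "c \<le> r"
  shows le_larger_root_iff: "r \<le> (a + c + sqrt ((a - c)\<^sup>2 + 4 * p)) / 2 \<longleftrightarrow> (r - a) * (r - c) \<le> p"
    and larger_root_le_iff: "(a + c + sqrt ((a - c)\<^sup>2 + 4 * p)) / 2 \<le> r \<longleftrightarrow> p \<le> (r - a) * (r - c)"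
proof -
  let ?s = "2 * r - a - c" and ?D = "(a - c)\<^sup>2 + 4 * p"
  have square: "?s\<^sup>2 = (a - c)\<^sup>2 + 4 * ((r - a) * (r - c))"
    by (simp add: power2_eq_square algebra_simps)
  have root: "sqrt (?s\<^sup>2) = ?s" using assms by simp
  have "r \<le> (a + c + sqrt ?D) / 2 \<longleftrightarrow> sqrt (?s\<^sup>2) \<le> sqrt ?D" unfolding root by auto
  then show "r \<le> (a + c + sqrt ?D) / 2 \<longleftrightarrow> (r - a) * (r - c) \<le> p"
    unfolding real_sqrt_le_iff square by simp
  have "(a + c + sqrt ?D) / 2 \<le> r \<longleftrightarrow> sqrt ?D \<le> sqrt (?s\<^sup>2)" unfolding root by auto
  then show "(a + c + sqrt ?D) / 2 \<le> r \<longleftrightarrow> p \<le> (r - a) * (r - c)"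
    unfolding real_sqrt_le_iff square by simp
qed

subsection \<open>Edge polynomials and links\<close>

definition edge_polynomial :: "'a set set \<Rightarrow> ('a \<Rightarrow> 'b::comm_semiring_1) \<Rightarrow> 'b" where
  "edge_polynomial E x = (\<Sum>e\<in>E. \<Prod>v\<in>e. x v)"

definition link :: "'a set set \<Rightarrow> 'a \<Rightarrow> 'a set set" where
  "link E i = (\<lambda>e. e - {i}) ` {e \<in> E. i \<in> e}"

abbreviation link_polynomial :: "'a set set \<Rightarrow> 'a \<Rightarrow> ('a \<Rightarrow> 'b::comm_semiring_1) \<Rightarrow> 'b" where
  "link_polynomial E i \<equiv> edge_polynomial (link E i)"

lemma edge_polynomial_cong:
  "(\<And>v. v \<in> \<Union>E \<Longrightarrow> x v = z v) \<Longrightarrow> edge_polynomial E x = edge_polynomial E z"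
  unfolding edge_polynomial_def by (intro sum.cong prod.cong) auto

lemma edge_polynomial_scale:
  "(\<And>e. e \<in> E \<Longrightarrow> card e = m) \<Longrightarrow> edge_polynomial E (\<lambda>v. t * x v) = t ^ m * edge_polynomial E x"
  by (simp add: edge_polynomial_def prod.distrib sum_distrib_left)

lemma edge_polynomial_nonneg:
  fixes x :: "'a \<Rightarrow> 'b::linordered_semidom"
  assumes "\<And>v. v \<in> \<Union>E \<Longrightarrow> 0 \<le> x v"
  shows "0 \<le> edge_polynomial E x"
  unfolding edge_polynomial_def by (intro sum_nonneg prod_nonneg assms) auto

lemma edge_polynomial_pos:
  fixes x :: "'a \<Rightarrow> 'b::linordered_semidom"
  assumes "finite E" "E \<noteq> {}" "\<And>v. v \<in> \<Union>E \<Longrightarrow> 0 < x v"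
  shows "0 < edge_polynomial E x"
  unfolding edge_polynomial_def using assms by (intro sum_pos prod_pos) auto

lemma edge_polynomial_mono:
  fixes x z :: "'a \<Rightarrow> 'b::linordered_semidom"
  assumes "\<And>v. v \<in> \<Union>E \<Longrightarrow> 0 \<le> x v \<and> x v \<le> z v"
  shows "edge_polynomial E x \<le> edge_polynomial E z"
  unfolding edge_polynomial_def by (intro sum_mono prod_mono assms) auto

lemma edge_polynomial_mono_inv:
  fixes x z :: "'a \<Rightarrow> 'b::linordered_semidom"
  assumes "edge_polynomial E x = edge_polynomial E z"
    and le: "\<And>v. v \<in> \<Union>E \<Longrightarrow> 0 < x v \<and> x v \<le> z v"
    and "finite E" "\<And>e. e \<in> E \<Longrightarrow> finite e" "v \<in> \<Union>E"
  shows "x v = z v"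
proof -
  obtain e where e: "e \<in> E" "v \<in> e" using \<open>v \<in> \<Union>E\<close> by blast
  have "(\<Prod>v\<in>e. x v) = (\<Prod>v\<in>e. z v)"
    by (rule sum_mono_inv[OF assms(1)[unfolded edge_polynomial_def] prod_mono])
      (use le e(1) \<open>finite E\<close> in \<open>auto intro: less_imp_le\<close>)
  then show ?thesis
    by (rule prod_mono_inv) (use assms e in auto)
qed

lemma norm_edge_polynomial_le:
  fixes x :: "'a \<Rightarrow> 'b::{real_normed_div_algebra,comm_semiring_1}"
  shows "norm (edge_polynomial E x) \<le> edge_polynomial E (\<lambda>v. norm (x v))"
  unfolding edge_polynomial_def by (rule order_trans[OF norm_sum]) (simp add: prod_norm)

lemma of_real_edge_polynomial:
  "edge_polynomial E (\<lambda>v. of_real (x v))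
     = (of_real (edge_polynomial E x) :: 'b::{real_algebra_1,comm_semiring_1})"
  by (simp add: edge_polynomial_def)

lemma continuous_on_edge_polynomial:
  "continuous_on UNIV (edge_polynomial E :: ('a \<Rightarrow> real) \<Rightarrow> real)"
  unfolding edge_polynomial_def
  by (intro continuous_intros continuous_on_product_coordinates)

lemma link_polynomial_eq:
  "link_polynomial E i x = (\<Sum>e | e \<in> E \<and> i \<in> e. \<Prod>v\<in>e - {i}. x v)"
proof -
  have "inj_on (\<lambda>e. e - {i}) {e \<in> E. i \<in> e}" by (auto simp: inj_on_def)
  then show ?thesis by (simp add: edge_polynomial_def link_def sum.reindex)
qed

lemma edge_polynomial_fun_upd:
  fixes x :: "'a \<Rightarrow> 'b::comm_ring_1"
  assumes "finite E" "\<And>e. e \<in> E \<Longrightarrow> finite e"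
  shows "edge_polynomial E (x(i := t)) = edge_polynomial E x + (t - x i) * link_polynomial E i x"
proof -
  have "(\<Prod>v\<in>e. (x(i := t)) v) = (\<Prod>v\<in>e. x v) + (t - x i) * (if i \<in> e then \<Prod>v\<in>e - {i}. x v else 0)"
    if "e \<in> E" for e
  proof (cases "i \<in> e")
    case True
    have "(\<Prod>v\<in>e - {i}. (x(i := t)) v) = (\<Prod>v\<in>e - {i}. x v)" by (rule prod.cong) auto
    then show ?thesis
      using True by (simp add: prod.remove[OF assms(2)[OF that] True] algebra_simps)
  next
    case False
    then have "(\<Prod>v\<in>e. (x(i := t)) v) = (\<Prod>v\<in>e. x v)" by (intro prod.cong) auto
    then show ?thesis using False by simp
  qed
  then have "edge_polynomial E (x(i := t))
      = (\<Sum>e\<in>E. \<Prod>v\<in>e. x v) + (t - x i) * (\<Sum>e\<in>E. if i \<in> e then \<Prod>v\<in>e - {i}. x v else 0)"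
    by (simp add: edge_polynomial_def sum.distrib sum_distrib_left)
  also have "\<dots> = edge_polynomial E x + (t - x i) * link_polynomial E i x"
    by (simp add: edge_polynomial_def[of E] link_polynomial_eq sum.inter_filter[OF assms(1)])
  finally show ?thesis .
qed

definition adjacent :: "nat set set \<Rightarrow> (nat \<times> nat) set" where
  "adjacent E = (\<Union>e\<in>E. vertex_pairs e)"

lemma adjacent_iff: "(i, j) \<in> adjacent E \<longleftrightarrow> i \<noteq> j \<and> (\<exists>e\<in>E. i \<in> e \<and> j \<in> e)"
  by (auto simp: adjacent_def vertex_pairs_def)

lemma adjacent_sym: "(i, j) \<in> adjacent E \<Longrightarrow> (j, i) \<in> adjacent E"
  by (auto simp: adjacent_iff)

lemma Union_link: "v \<in> \<Union>(link E i) \<longleftrightarrow> (i, v) \<in> adjacent E"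
  by (auto simp: adjacent_iff link_def)

lemma b_prime_link_polynomial: "b_prime k E x i = link_polynomial E i x / x i ^ (k - 1)"
  by (simp add: b_prime_def link_polynomial_eq)

subsection \<open>Eigenvalues of the signless Laplacian tensor\<close>

definition tensor_apply :: "nat \<Rightarrow> nat \<Rightarrow> tensor \<Rightarrow> (nat \<Rightarrow> complex) \<Rightarrow> nat \<Rightarrow> complex" where
  "tensor_apply k n T x i =
     (\<Sum>js | length js = k - 1 \<and> set js \<subseteq> {1..n}. T (i # js) * (\<Prod>j\<leftarrow>js. x j))"

lemma tensor_eigenvalue_iff:
  "tensor_eigenvalue k n T lam \<longleftrightarrow>
     (\<exists>x. (\<exists>i\<in>{1..n}. x i \<noteq> 0) \<and> (\<forall>i\<in>{1..n}. tensor_apply k n T x i = lam * x i ^ (k - 1)))"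
  by (simp add: tensor_eigenvalue_def tensor_apply_def)

locale k_uniform_hypergraph =
  fixes k n :: nat and E :: "nat set set"
  assumes k_pos: "0 < k"
    and uniform: "uniform_hypergraph k n E"
begin

lemma edge_subset: "e \<in> E \<Longrightarrow> e \<subseteq> {1..n}"
  and card_edge: "e \<in> E \<Longrightarrow> card e = k"
  using uniform by (auto simp: uniform_hypergraph_def)

lemma finite_edge: "e \<in> E \<Longrightarrow> finite e"
  using edge_subset finite_subset by blast

lemma finite_edges: "finite E"
  using edge_subset by (intro finite_subset[of E "Pow {1..n}"]) auto

lemma finite_link: "finite (link E i)"
  and finite_link_edge: "f \<in> link E i \<Longrightarrow> finite f"
  and card_link_edge: "f \<in> link E i \<Longrightarrow> card f = k - 1"
  using finite_edges finite_edge card_edge by (auto simp: link_def card_Diff_singleton)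

lemma adjacent_vertices: "(i, j) \<in> adjacent E \<Longrightarrow> i \<in> {1..n} \<and> j \<in> {1..n}"
  using edge_subset unfolding adjacent_iff by blast

lemma edge_vertex: "v \<in> \<Union>E \<Longrightarrow> v \<in> {1..n}"
  using edge_subset by blast

lemma link_vertex: "v \<in> \<Union>(link E i) \<Longrightarrow> v \<in> {1..n}"
  unfolding Union_link using adjacent_vertices by blast

lemma finite_vertex_pairs: "e \<in> E \<Longrightarrow> finite (vertex_pairs e)"
  by (rule finite_subset[of _ "e \<times> e"]) (auto simp: vertex_pairs_def finite_edge)

lemma finite_adjacent: "finite (adjacent E)"
  by (simp add: adjacent_def finite_edges finite_vertex_pairs)

lemma degree_tensor_apply:
  assumes "i \<in> {1..n}"
  shows "tensor_apply k n (degree_tensor k E) x i = of_nat (vertex_degree E i) * x i ^ (k - 1)"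
proof -
  let ?J = "{js. length js = k - 1 \<and> set js \<subseteq> {1..n}}"
  have "finite ?J"
    using finite_lists_length_eq[of "{1..n}" "k - 1"] by (simp add: conj_commute)
  have "replicate k i = i # replicate (k - 1) i"
    using k_pos by (cases k) auto
  then have "tensor_apply k n (degree_tensor k E) x i
      = (\<Sum>js\<in>?J. if js = replicate (k - 1) i then of_nat (vertex_degree E i) * x i ^ (k - 1) else 0)"
    unfolding tensor_apply_def
    by (intro sum.cong) (auto simp: degree_tensor_def prod_list_replicate)
  then show ?thesis
    using assms \<open>finite ?J\<close> by (simp add: set_replicate_conv_if)
qed

lemma lists_completing_edge:
  "{js. length js = k - 1 \<and> set js \<subseteq> {1..n} \<and> insert i (set js) \<in> E}
     = (\<Union>f\<in>link E i. permutations_of_set f)" (is "?L = ?R")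
proof (intro subset_antisym subsetI)
  fix js assume "js \<in> ?L"
  then have len: "length js = k - 1" and edge: "insert i (set js) \<in> E" by auto
  have "card (set js) < card (insert i (set js))"
    using card_length[of js] len card_edge[OF edge] k_pos by linarith
  then have "i \<notin> set js" by (auto simp: insert_absorb)
  then have "set js = insert i (set js) - {i}" by blast
  then have "set js \<in> link E i" using edge unfolding link_def by blast
  moreover have "distinct js"
    using card_link_edge[OF calculation] len by (intro card_distinct) simp
  ultimately show "js \<in> ?R" by auto
next
  fix js assume "js \<in> ?R"
  then obtain e where e: "e \<in> E" "i \<in> e" and js: "set js = e - {i}" "distinct js"
    by (auto simp: link_def dest: permutations_of_setD)
  have "length js = k - 1"
    using distinct_card[OF js(2)] js(1) e card_edge finite_edge by (simp add: card_Diff_singleton)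
  then show "js \<in> ?L" using js(1) e edge_subset by (auto simp: insert_absorb)
qed

lemma adjacency_tensor_apply:
  "tensor_apply k n (adjacency_tensor k E) x i = link_polynomial E i x"
proof -
  let ?J = "{js. length js = k - 1 \<and> set js \<subseteq> {1..n}}" and ?p = "\<lambda>js. (\<Prod>j\<leftarrow>js. x j) / fact (k - 1)"
  have "finite ?J"
    using finite_lists_length_eq[of "{1..n}" "k - 1"] by (simp add: conj_commute)
  have "tensor_apply k n (adjacency_tensor k E) x i
      = (\<Sum>js\<in>?J. if insert i (set js) \<in> E then ?p js else 0)"
    unfolding tensor_apply_def by (intro sum.cong) (auto simp: adjacency_tensor_def)
  also have "\<dots> = (\<Sum>js\<in>{js \<in> ?J. insert i (set js) \<in> E}. ?p js)"
    by (rule sum.inter_filter[symmetric]) fact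
  also have "{js \<in> ?J. insert i (set js) \<in> E} = (\<Union>f\<in>link E i. permutations_of_set f)"
    using lists_completing_edge[of i] by simp
  also have "(\<Sum>js\<in>(\<Union>f\<in>link E i. permutations_of_set f). ?p js)
      = (\<Sum>f\<in>link E i. \<Sum>js\<in>permutations_of_set f. ?p js)"
    by (rule sum.UNION_disjoint) (auto simp: finite_link dest: permutations_of_setD)
  also have "\<dots> = (\<Sum>f\<in>link E i. \<Sum>js\<in>permutations_of_set f. (\<Prod>v\<in>f. x v) / fact (k - 1))"
    by (intro sum.cong) (auto simp: permutations_of_set_def prod.distinct_set_conv_list)
  also have "\<dots> = link_polynomial E i x"
    by (simp add: edge_polynomial_def finite_link_edge card_link_edge)
  finally show ?thesis .
qed

lemma signless_laplacian_tensor_apply: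
  assumes "i \<in> {1..n}"
  shows "tensor_apply k n (signless_laplacian_tensor k E) x i
    = of_nat (vertex_degree E i) * x i ^ (k - 1) + link_polynomial E i x"
proof -
  have "tensor_apply k n (signless_laplacian_tensor k E) x i
      = tensor_apply k n (degree_tensor k E) x i + tensor_apply k n (adjacency_tensor k E) x i"
    by (simp add: tensor_apply_def signless_laplacian_tensor_def distrib_right sum.distrib)
  then show ?thesis by (simp add: degree_tensor_apply[OF assms] adjacency_tensor_apply)
qed

definition positive :: "(nat \<Rightarrow> real) \<Rightarrow> bool" where
  "positive x \<longleftrightarrow> (\<forall>i\<in>{1..n}. 0 < x i)"

definition nonneg :: "(nat \<Rightarrow> real) \<Rightarrow> bool" where
  "nonneg x \<longleftrightarrow> (\<forall>i\<in>{1..n}. 0 \<le> x i)"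

definition row_sum :: "(nat \<Rightarrow> real) \<Rightarrow> nat \<Rightarrow> real" where
  "row_sum x i = real (vertex_degree E i) + b_prime k E x i"

lemma positiveD: "positive x \<Longrightarrow> i \<in> {1..n} \<Longrightarrow> 0 < x i"
  by (simp add: positive_def)

lemma nonnegD: "nonneg x \<Longrightarrow> i \<in> {1..n} \<Longrightarrow> 0 \<le> x i"
  by (simp add: nonneg_def)

lemma row_sum_mult_power:
  assumes "positive x" "i \<in> {1..n}"
  shows "row_sum x i * x i ^ (k - 1)
    = real (vertex_degree E i) * x i ^ (k - 1) + link_polynomial E i x"
  using positiveD[OF assms] by (simp add: row_sum_def b_prime_link_polynomial field_simps)

lemma b_prime_proportional:
  assumes "c \<noteq> 0" "\<And>v. v \<in> {1..n} \<Longrightarrow> x v = c * z v" "i \<in> {1..n}"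
  shows "b_prime k E x i = b_prime k E z i"
proof -
  have "link_polynomial E i x = link_polynomial E i (\<lambda>v. c * z v)"
    by (intro edge_polynomial_cong assms(2) link_vertex)
  also have "\<dots> = c ^ (k - 1) * link_polynomial E i z"
    by (rule edge_polynomial_scale) (rule card_link_edge)
  finally show ?thesis
    using assms by (simp add: b_prime_link_polynomial power_mult_distrib)
qed

lemma tensor_eigenvalue_if_row_sum_eq:
  assumes "positive x" "{1..n} \<noteq> {}" and r: "\<forall>i\<in>{1..n}. row_sum x i = r"
  shows "tensor_eigenvalue k n (signless_laplacian_tensor k E) (of_real r)"
  unfolding tensor_eigenvalue_iff
proof (intro exI conjI ballI)
  show "\<exists>i\<in>{1..n}. complex_of_real (x i) \<noteq> 0"
    using assms(1,2) by (force dest: positiveD)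
  fix i assume i: "i \<in> {1..n}"
  have "complex_of_real r * of_real (x i) ^ (k - 1) = of_real (row_sum x i * x i ^ (k - 1))"
    using r i by simp
  then show "tensor_apply k n (signless_laplacian_tensor k E) (\<lambda>i. complex_of_real (x i)) i
      = of_real r * of_real (x i) ^ (k - 1)"
    unfolding row_sum_mult_power[OF assms(1) i] signless_laplacian_tensor_apply[OF i]
    by (simp add: of_real_edge_polynomial)
qed

lemma cmod_eigenvector_le:
  assumes "i \<in> {1..n}"
    and "tensor_apply k n (signless_laplacian_tensor k E) y i = lam * y i ^ (k - 1)"
  shows "cmod lam * cmod (y i) ^ (k - 1)
    \<le> real (vertex_degree E i) * cmod (y i) ^ (k - 1) + link_polynomial E i (\<lambda>v. cmod (y v))"
proof -
  have "cmod lam * cmod (y i) ^ (k - 1)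
      = cmod (of_nat (vertex_degree E i) * y i ^ (k - 1) + link_polynomial E i y)"
    unfolding signless_laplacian_tensor_apply[OF assms(1), symmetric] assms(2)
    by (simp add: norm_mult norm_power)
  also have "\<dots> \<le> real (vertex_degree E i) * cmod (y i) ^ (k - 1) + cmod (link_polynomial E i y)"
    by (rule order_trans[OF norm_triangle_ineq]) (simp add: norm_mult norm_power)
  finally show ?thesis using norm_edge_polynomial_le[of "link E i" y] by linarith
qed

lemma cmod_eigenvalue_le:
  assumes x: "positive x" and r: "\<forall>i\<in>{1..n}. row_sum x i \<le> r"
    and "tensor_eigenvalue k n (signless_laplacian_tensor k E) lam"
  shows "cmod lam \<le> r"
proof -
  obtain y v where v: "v \<in> {1..n}" "y v \<noteq> 0" and y: "\<And>i. i \<in> {1..n} \<Longrightarrow>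
      tensor_apply k n (signless_laplacian_tensor k E) y i = lam * y i ^ (k - 1)"
    using assms(3) unfolding tensor_eigenvalue_iff by blast
  obtain i where i: "i \<in> {1..n}"
    and max: "\<And>v. v \<in> {1..n} \<Longrightarrow> cmod (y v) / x v \<le> cmod (y i) / x i"
    using ex_arg_max[of "{1..n}" "\<lambda>v. cmod (y v) / x v"] v(1) by blast
  define t where "t = cmod (y i) / x i"
  have le: "cmod (y v) \<le> t * x v" if "v \<in> {1..n}" for v
    using max[OF that] positiveD[OF x that] by (simp add: t_def field_simps)
  have yi: "cmod (y i) = t * x i" using positiveD[OF x i] by (simp add: t_def)
  have "0 < cmod (y v) / x v" using v positiveD[OF x v(1)] by simp
  then have "0 < t" using max[OF v(1)] by (simp add: t_def)
  have "link_polynomial E i (\<lambda>v. cmod (y v)) \<le> link_polynomial E i (\<lambda>v. t * x v)"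
    by (intro edge_polynomial_mono conjI norm_ge_zero le link_vertex)
  also have "\<dots> = t ^ (k - 1) * link_polynomial E i x"
    by (rule edge_polynomial_scale) (rule card_link_edge)
  finally have "cmod lam * (t * x i) ^ (k - 1) \<le> t ^ (k - 1) * (row_sum x i * x i ^ (k - 1))"
    using cmod_eigenvector_le[OF i y[OF i]] unfolding row_sum_mult_power[OF x i] yi
    by (simp add: power_mult_distrib algebra_simps)
  then have "cmod lam * (t * x i) ^ (k - 1) \<le> row_sum x i * (t * x i) ^ (k - 1)"
    by (simp add: power_mult_distrib mult_ac)
  then have "cmod lam \<le> row_sum x i"
    using \<open>0 < t\<close> positiveD[OF x i] by simp
  with r i show ?thesis by force
qed

subsection \<open>The signless Laplacian form\<close>

definition signless_form :: "(nat \<Rightarrow> real) \<Rightarrow> real" where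
  "signless_form x = (\<Sum>i=1..n. real (vertex_degree E i) * x i ^ k) + real k * edge_polynomial E x"

definition power_sum :: "(nat \<Rightarrow> real) \<Rightarrow> real" where
  "power_sum x = (\<Sum>i=1..n. x i ^ k)"

definition rayleigh_maximiser :: "real \<Rightarrow> (nat \<Rightarrow> real) \<Rightarrow> bool" where
  "rayleigh_maximiser r x \<longleftrightarrow> nonneg x \<and> signless_form x = r * power_sum x
     \<and> (\<forall>z. nonneg z \<longrightarrow> signless_form z \<le> r * power_sum z)"

lemma rayleigh_maximiserD:
  assumes "rayleigh_maximiser r x"
  shows "nonneg x" "signless_form x = r * power_sum x"
    and "nonneg z \<Longrightarrow> signless_form z \<le> r * power_sum z"
  using assms by (auto simp: rayleigh_maximiser_def)

lemma signless_form_scale: "signless_form (\<lambda>v. t * x v) = t ^ k * signless_form x"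
proof -
  have "edge_polynomial E (\<lambda>v. t * x v) = t ^ k * edge_polynomial E x"
    by (rule edge_polynomial_scale) (rule card_edge)
  then show ?thesis
    by (simp add: signless_form_def power_mult_distrib distrib_left sum_distrib_left mult_ac)
qed

lemma signless_form_cong:
  assumes "\<And>v. v \<in> {1..n} \<Longrightarrow> x v = z v"
  shows "signless_form x = signless_form z"
proof -
  have "edge_polynomial E x = edge_polynomial E z"
    by (intro edge_polynomial_cong assms edge_vertex)
  then show ?thesis using assms by (simp add: signless_form_def)
qed

lemma signless_form_nonneg:
  assumes "nonneg x" shows "0 \<le> signless_form x"
proof -
  have "0 \<le> edge_polynomial E x"
    by (intro edge_polynomial_nonneg nonnegD[OF assms] edge_vertex)
  then show ?thesis
    using assms by (auto simp: signless_form_def nonneg_def intro!: add_nonneg_nonneg sum_nonneg)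
qed

lemma continuous_on_signless_form: "continuous_on UNIV signless_form"
  unfolding signless_form_def
  by (intro continuous_intros continuous_on_product_coordinates continuous_on_edge_polynomial)

lemma signless_form_fun_upd:
  assumes "i \<in> {1..n}"
  shows "signless_form (x(i := t)) = signless_form x
    + real (vertex_degree E i) * (t ^ k - x i ^ k) + real k * (t - x i) * link_polynomial E i x"
  using sum_fun_upd[of "{1..n}" i "\<lambda>v a. real (vertex_degree E v) * a ^ k" x t] assms
  by (simp add: signless_form_def edge_polynomial_fun_upd finite_edges finite_edge algebra_simps)

lemma signless_form_raise_zeros:
  assumes "nonneg x" and e: "e \<in> E" and "0 \<le> \<epsilon>"
    and Z: "Z = {v \<in> e. x v = 0}" "Z \<noteq> {}"
  shows "signless_form x + real k * (\<epsilon> ^ card Z * (\<Prod>v\<in>e - Z. x v))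
    \<le> signless_form (\<lambda>v. if v \<in> Z then \<epsilon> else x v)"
proof -
  define z where "z v = (if v \<in> Z then \<epsilon> else x v)" for v
  have le: "0 \<le> x v \<and> x v \<le> z v" if "v \<in> {1..n}" for v
    using nonnegD[OF \<open>nonneg x\<close> that] \<open>0 \<le> \<epsilon>\<close> by (auto simp: z_def Z)
  have split: "edge_polynomial E w = (\<Prod>v\<in>e. w v) + edge_polynomial (E - {e}) w" for w :: "nat \<Rightarrow> real"
    unfolding edge_polynomial_def by (rule sum.remove[OF finite_edges e])
  have "Z \<subseteq> e" by (auto simp: Z)
  have "(\<Prod>v\<in>e. z v) = (\<Prod>v\<in>Z. z v) * (\<Prod>v\<in>e - Z. z v)"
    using prod.subset_diff[OF \<open>Z \<subseteq> e\<close> finite_edge[OF e]] by (simp add: mult.commute)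
  also have "\<dots> = \<epsilon> ^ card Z * (\<Prod>v\<in>e - Z. x v)"
    by (simp add: z_def)
  finally have "(\<Prod>v\<in>e. z v) = \<epsilon> ^ card Z * (\<Prod>v\<in>e - Z. x v)" .
  moreover have "(\<Prod>v\<in>e. x v) = 0"
    using finite_edge[OF e] Z by (auto simp: prod_zero_iff)
  moreover have "edge_polynomial (E - {e}) x \<le> edge_polynomial (E - {e}) z"
    by (intro edge_polynomial_mono le edge_vertex) blast
  ultimately have "edge_polynomial E x + \<epsilon> ^ card Z * (\<Prod>v\<in>e - Z. x v) \<le> edge_polynomial E z"
    unfolding split by linarith
  then have "real k * (edge_polynomial E x + \<epsilon> ^ card Z * (\<Prod>v\<in>e - Z. x v))
      \<le> real k * edge_polynomial E z"
    by (rule mult_left_mono) simp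
  moreover have "(\<Sum>v=1..n. real (vertex_degree E v) * x v ^ k)
      \<le> (\<Sum>v=1..n. real (vertex_degree E v) * z v ^ k)"
    using le by (intro sum_mono mult_left_mono power_mono) auto
  ultimately show ?thesis
    unfolding signless_form_def z_def[symmetric] by (simp add: distrib_left)
qed

lemma row_sum_rayleigh_maximiser:
  assumes x: "rayleigh_maximiser r x" and i: "i \<in> {1..n}" "0 < x i"
  shows "row_sum x i = r"
proof -
  let ?d = "real (vertex_degree E i)" and ?S = "link_polynomial E i x"
  define \<phi> where "\<phi> t = (r - ?d) * t ^ k - real k * ?S * t" for t
  have min: "\<phi> (x i) \<le> \<phi> t" if "\<bar>x i - t\<bar> < x i" for t
  proof -
    have "nonneg (x(i := t))"
      using rayleigh_maximiserD(1)[OF x] that by (auto simp: nonneg_def)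
    then have "signless_form (x(i := t)) \<le> r * power_sum (x(i := t))"
      by (rule rayleigh_maximiserD(3)[OF x])
    also have "\<dots> = signless_form x + r * (t ^ k - x i ^ k)"
      using sum_fun_upd[of "{1..n}" i "\<lambda>v a. a ^ k" x t] i(1) rayleigh_maximiserD(2)[OF x]
      by (simp add: power_sum_def distrib_left)
    finally show ?thesis
      unfolding signless_form_fun_upd[OF i(1)] \<phi>_def by (simp add: algebra_simps)
  qed
  have "DERIV \<phi> (x i) :> (r - ?d) * (real k * x i ^ (k - 1)) - real k * ?S"
    unfolding \<phi>_def by (auto intro!: derivative_eq_intros)
  then have "(r - ?d) * (real k * x i ^ (k - 1)) - real k * ?S = 0"
    using i(2) min by (blast intro: DERIV_local_min)
  then have "(r - ?d) * x i ^ (k - 1) = ?S" using k_pos by simp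
  then show ?thesis using i(2) by (simp add: row_sum_def b_prime_link_polynomial field_simps)
qed

text \<open>Raising the zeros \<open>Z\<close> of a maximiser on an edge to \<open>\<epsilon>\<close> gains at least the order \<open>\<epsilon>\<^bsup>|Z|\<^esup>\<close> in the
  form and costs at most the order \<open>\<epsilon>\<^bsup>k\<^esup>\<close> in the power sum.\<close>

lemma rayleigh_maximiser_zeros_bound:
  assumes x: "rayleigh_maximiser r x" and "0 \<le> r" and e: "e \<in> E"
    and Z: "Z = {v \<in> e. x v = 0}" "Z \<noteq> {}" "card Z < k" and \<epsilon>: "0 < \<epsilon>" "\<epsilon> \<le> 1"
  shows "real k * (\<Prod>v\<in>e - Z. x v) \<le> r * real n * \<epsilon>"
proof -
  let ?z = "\<lambda>v. if v \<in> Z then \<epsilon> else x v" and ?P = "\<Prod>v\<in>e - Z. x v"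
  note nonneg = rayleigh_maximiserD(1)[OF x]
  have "real k * (\<epsilon> ^ card Z * ?P) + signless_form x \<le> signless_form ?z"
    using signless_form_raise_zeros[OF nonneg e less_imp_le[OF \<epsilon>(1)] Z(1,2)]
    by (simp add: add.commute)
  also have "\<dots> \<le> r * power_sum ?z"
    using nonneg \<epsilon> by (intro rayleigh_maximiserD(3)[OF x]) (auto simp: nonneg_def)
  also have "\<dots> \<le> r * (\<Sum>v=1..n. x v ^ k + \<epsilon> ^ k)"
    unfolding power_sum_def using nonneg \<epsilon> \<open>0 \<le> r\<close>
    by (intro mult_left_mono sum_mono) (auto simp: nonneg_def)
  also have "\<dots> = signless_form x + r * real n * \<epsilon> ^ k"
    by (simp add: rayleigh_maximiserD(2)[OF x] power_sum_def sum.distrib distrib_left mult_ac)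
  finally have "real k * (\<epsilon> ^ card Z * ?P) \<le> r * real n * \<epsilon> ^ k" by simp
  also have "\<dots> \<le> r * real n * \<epsilon> ^ Suc (card Z)"
    using \<epsilon> \<open>card Z < k\<close> \<open>0 \<le> r\<close> by (intro mult_left_mono power_decreasing) auto
  finally have "\<epsilon> ^ card Z * (real k * ?P) \<le> \<epsilon> ^ card Z * (r * real n * \<epsilon>)"
    by (simp add: mult_ac)
  then show ?thesis using \<epsilon>(1) by simp
qed

lemma rayleigh_maximiser_pos_on_edge:
  assumes x: "rayleigh_maximiser r x" and "0 \<le> r"
    and e: "e \<in> E" "i \<in> e" "0 < x i" "j \<in> e"
  shows "0 < x j"
proof (rule ccontr)
  assume "\<not> 0 < x j"
  define Z where "Z = {v \<in> e. x v = 0}"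
  have pos_or_zero: "0 < x v \<or> x v = 0" if "v \<in> e" for v
    using nonnegD[OF rayleigh_maximiserD(1)[OF x], of v] edge_vertex[of v] that e(1) by force
  then have "Z \<noteq> {}" using \<open>\<not> 0 < x j\<close> e(4) by (auto simp: Z_def)
  have "i \<notin> Z" "Z \<subseteq> e" using e(3) by (auto simp: Z_def)
  then have "card Z < k"
    using psubset_card_mono[OF finite_edge[OF e(1)], of Z] card_edge[OF e(1)] e(2) by blast
  have "real k * (\<Prod>v\<in>e - Z. x v) \<le> 0"
    by (rule le_mult_small_imp_nonpos)
      (rule rayleigh_maximiser_zeros_bound[OF x \<open>0 \<le> r\<close> e(1) Z_def \<open>Z \<noteq> {}\<close> \<open>card Z < k\<close>])
  moreover have "0 < (\<Prod>v\<in>e - Z. x v)"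
    using pos_or_zero by (intro prod_pos) (auto simp: Z_def)
  ultimately show False using k_pos by (simp add: mult_le_0_iff)
qed

lemma rayleigh_maximiser_exists:
  assumes "{1..n} \<noteq> {}"
  obtains r x where "0 \<le> r" "rayleigh_maximiser r x" "power_sum x = 1"
proof -
  obtain x where x: "\<And>i. i \<in> {1..n} \<Longrightarrow> 0 \<le> x i" "(\<Sum>i=1..n. x i ^ k) = 1"
    and max: "\<And>z. (\<And>i. i \<in> {1..n} \<Longrightarrow> 0 \<le> z i) \<Longrightarrow>
      signless_form z \<le> signless_form x * (\<Sum>i=1..n. z i ^ k)"
    using homogeneous_maximiser[OF finite_atLeastAtMost assms k_pos continuous_on_signless_form
        signless_form_scale signless_form_cong] by blast
  have "nonneg x" using x(1) by (simp add: nonneg_def)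
  then have "rayleigh_maximiser (signless_form x) x"
    using x(2) max by (simp add: rayleigh_maximiser_def power_sum_def nonneg_def)
  then show ?thesis
    using signless_form_nonneg[OF \<open>nonneg x\<close>] x(2) by (intro that) (auto simp: power_sum_def)
qed

end

subsection \<open>Comparing two positive vectors on a connected hypergraph\<close>

locale connected_k_uniform_hypergraph = k_uniform_hypergraph +
  assumes k_ge_2: "2 \<le> k"
    and connected: "connected_hypergraph n E"
    and nonempty: "E \<noteq> {}"
begin

lemma adjacent_induct [consumes 2, case_names base step]:
  assumes "u \<in> {1..n}" "v \<in> {1..n}" "P u"
    and step: "\<And>i j. (i, j) \<in> adjacent E \<Longrightarrow> P i \<Longrightarrow> P j"
  shows "P v"
proof -
  obtain vs es where "is_walk n E vs es" and ends: "hd vs = u" "last vs = v"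
    using connected assms(1,2) unfolding connected_hypergraph_def by blast
  then have len: "length vs = length es + 1" and es: "set es \<subseteq> E"
    and walk: "\<And>m. m < length es \<Longrightarrow> {vs ! m, vs ! (m + 1)} \<subseteq> es ! m"
    by (auto simp: is_walk_def)
  have vs: "vs \<noteq> []" using len by auto
  have "P (vs ! m)" if "m \<le> length es" for m
    using that
  proof (induction m)
    case 0
    then show ?case using \<open>P u\<close> ends(1) vs by (simp add: hd_conv_nth)
  next
    case (Suc m)
    then have "es ! m \<in> E" "{vs ! m, vs ! Suc m} \<subseteq> es ! m"
      using es walk[of m] by auto
    then have "vs ! m = vs ! Suc m \<or> (vs ! m, vs ! Suc m) \<in> adjacent E"
      unfolding adjacent_iff by blast
    then show ?case using Suc step by auto
  qed
  from this[of "length es"] show ?thesis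
    using ends(2) vs len by (simp add: last_conv_nth)
qed

lemma vertex_pairs_nonempty:
  assumes "e \<in> E" shows "vertex_pairs e \<noteq> {}"
proof -
  have "\<not> card e \<le> Suc 0" using card_edge[OF assms] k_ge_2 by simp
  then show ?thesis
    unfolding card_le_Suc0_iff_eq[OF finite_edge[OF assms]] by (auto simp: vertex_pairs_def)
qed

lemma adjacent_nonempty: "adjacent E \<noteq> {}"
  using nonempty vertex_pairs_nonempty by (auto simp: adjacent_def)

lemma vertices_nonempty: "{1..n} \<noteq> {}"
  using adjacent_nonempty adjacent_vertices by fast

lemma neighbour_exists:
  assumes "i \<in> {1..n}" shows "\<exists>j. (i, j) \<in> adjacent E"
proof -
  obtain u v where uv: "(u, v) \<in> adjacent E" using adjacent_nonempty by auto
  then have "u \<in> {1..n}" using adjacent_vertices by blast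
  from this assms show ?thesis
    by (induction rule: adjacent_induct) (use uv adjacent_sym in blast)+
qed

lemma common_neighbour:
  assumes "3 \<le> k" "(i, j) \<in> adjacent E"
  obtains w where "(i, w) \<in> adjacent E" "(j, w) \<in> adjacent E"
proof -
  obtain e where e: "e \<in> E" "i \<in> e" "j \<in> e" using assms(2) by (auto simp: adjacent_iff)
  have "card {i, j} \<le> 2" by (simp add: card_insert_if)
  then have "\<not> e \<subseteq> {i, j}"
    using card_mono[of "{i, j}" e] card_edge[OF e(1)] assms(1) by auto
  then obtain w where "w \<in> e" "w \<noteq> i" "w \<noteq> j" by blast
  then show ?thesis using e by (intro that[of w]) (auto simp: adjacent_iff)
qed

lemma maximal_neighbour:
  fixes f :: "nat \<Rightarrow> 'b::linorder"
  assumes "i \<in> {1..n}"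
  shows "\<exists>j. (i, j) \<in> adjacent E \<and> (\<forall>v. (i, v) \<in> adjacent E \<longrightarrow> f v \<le> f j)"
proof -
  have "finite {j. (i, j) \<in> adjacent E}"
    by (rule finite_subset[of _ "{1..n}"]) (use adjacent_vertices in auto)
  moreover have "{j. (i, j) \<in> adjacent E} \<noteq> {}"
    using neighbour_exists[OF assms] by blast
  ultimately show ?thesis
    using ex_arg_max[of "{j. (i, j) \<in> adjacent E}" f] by simp
qed

lemma link_polynomial_pos:
  assumes "positive x" "i \<in> {1..n}"
  shows "0 < link_polynomial E i x"
proof (rule edge_polynomial_pos[OF finite_link])
  show "link E i \<noteq> {}" using neighbour_exists[OF assms(2)] Union_link by blast
  show "0 < x v" if "v \<in> \<Union>(link E i)" for v
    using positiveD[OF assms(1) link_vertex[OF that]] .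
qed

lemma b_prime_pos: "positive x \<Longrightarrow> i \<in> {1..n} \<Longrightarrow> 0 < b_prime k E x i"
  by (simp add: b_prime_link_polynomial link_polynomial_pos positiveD)

lemma
  assumes x: "positive x" and z: "positive z"
    and le: "\<forall>v. (i, v) \<in> adjacent E \<longrightarrow> x v / z v \<le> m"
  shows link_polynomial_le: "link_polynomial E i x \<le> m ^ (k - 1) * link_polynomial E i z" (is ?le)
    and ratio_eq_if_link_polynomial_eq:
      "link_polynomial E i x = m ^ (k - 1) * link_polynomial E i z
        \<Longrightarrow> (i, v) \<in> adjacent E \<Longrightarrow> x v / z v = m"
proof -
  have scale: "m ^ (k - 1) * link_polynomial E i z = link_polynomial E i (\<lambda>v. m * z v)"
    by (rule edge_polynomial_scale[symmetric]) (rule card_link_edge)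
  have bounds: "0 < x v \<and> x v \<le> m * z v" if "v \<in> \<Union>(link E i)" for v
    using le that positiveD[OF x link_vertex] positiveD[OF z link_vertex]
    by (simp add: Union_link divide_le_eq del: Union_iff)
  show ?le
    unfolding scale using bounds by (intro edge_polynomial_mono) (auto intro: less_imp_le)
  assume eq: "link_polynomial E i x = m ^ (k - 1) * link_polynomial E i z"
    and v: "(i, v) \<in> adjacent E"
  have "x v = m * z v"
    by (rule edge_polynomial_mono_inv[OF eq[unfolded scale] bounds finite_link finite_link_edge])
      (use v Union_link in blast)+
  then show "x v / z v = m"
    using positiveD[OF z] adjacent_vertices[OF v] by force
qed

lemma
  assumes x: "positive x" and z: "positive z" and "(i, j) \<in> adjacent E"
    and i: "\<forall>v. (j, v) \<in> adjacent E \<longrightarrow> x v / z v \<le> x i / z i"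
    and j: "\<forall>v. (i, v) \<in> adjacent E \<longrightarrow> x v / z v \<le> x j / z j"
  shows b_prime_mult_le:
      "b_prime k E x i * b_prime k E x j \<le> b_prime k E z i * b_prime k E z j" (is ?le)
    and ratio_eq_if_b_prime_mult_le:
      "b_prime k E z i * b_prime k E z j \<le> b_prime k E x i * b_prime k E x j
        \<Longrightarrow> (i, v) \<in> adjacent E \<Longrightarrow> x v / z v = x j / z j"
proof -
  define A where "A = (x j / z j) ^ (k - 1) * link_polynomial E i z"
  define B where "B = (x i / z i) ^ (k - 1) * link_polynomial E j z"
  define D where "D = (x i * x j) ^ (k - 1)"
  have V: "i \<in> {1..n}" "j \<in> {1..n}" using adjacent_vertices assms(3) by auto
  note pos = V[THEN positiveD[OF x]] V[THEN positiveD[OF z]]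
  have bounds: "0 < link_polynomial E i x" "link_polynomial E i x \<le> A"
    "0 < link_polynomial E j x" "link_polynomial E j x \<le> B"
    using V[THEN link_polynomial_pos[OF x]] link_polynomial_le[OF x z i]
      link_polynomial_le[OF x z j]
    by (simp_all add: A_def B_def)
  have D: "0 < D" using pos by (simp add: D_def)
  have cleared:
    "b_prime k E x i * b_prime k E x j * D = link_polynomial E i x * link_polynomial E j x"
    "b_prime k E z i * b_prime k E z j * D = A * B"
    using pos
    by (simp_all add: b_prime_link_polynomial A_def B_def D_def power_mult_distrib power_divide mult_ac)
  have "link_polynomial E i x * link_polynomial E j x \<le> A * B"
    using bounds by (intro mult_mono) auto
  then show ?le using D unfolding cleared[symmetric] by simp
  assume "b_prime k E z i * b_prime k E z j \<le> b_prime k E x i * b_prime k E x j"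
    and v: "(i, v) \<in> adjacent E"
  then have "A * B \<le> link_polynomial E i x * link_polynomial E j x"
    unfolding cleared[symmetric] using D by simp
  moreover have "link_polynomial E i x * link_polynomial E j x < A * B"
    if "link_polynomial E i x < A"
    using that bounds by (intro mult_less_le_imp_less) auto
  ultimately have "link_polynomial E i x = A" using bounds(2) by argo
  then show "x v / z v = x j / z j"
    unfolding A_def by (rule ratio_eq_if_link_polynomial_eq[OF x z j _ v])
qed

lemma exists_b_prime_mult_le:
  assumes "positive x" "positive z"
  shows "\<exists>(i, j)\<in>adjacent E. b_prime k E x i * b_prime k E x j \<le> b_prime k E z i * b_prime k E z j"
proof -
  obtain i where i: "i \<in> {1..n}" "\<And>v. v \<in> {1..n} \<Longrightarrow> x v / z v \<le> x i / z i"
    using ex_arg_max[OF finite_atLeastAtMost vertices_nonempty, of "\<lambda>v. x v / z v"] by blast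
  obtain j where "(i, j) \<in> adjacent E" "\<forall>v. (i, v) \<in> adjacent E \<longrightarrow> x v / z v \<le> x j / z j"
    using maximal_neighbour[OF i(1), of "\<lambda>v. x v / z v"] by blast
  moreover from this have "b_prime k E x i * b_prime k E x j \<le> b_prime k E z i * b_prime k E z j"
    using i(2) adjacent_vertices by (intro b_prime_mult_le[OF assms]) simp_all
  ultimately show ?thesis by blast
qed

lemma proportional_if_b_prime_mult_le:
  assumes "3 \<le> k" and x: "positive x" and z: "positive z"
    and le: "\<And>i j. (i, j) \<in> adjacent E \<Longrightarrow>
      b_prime k E z i * b_prime k E z j \<le> b_prime k E x i * b_prime k E x j"
  obtains c where "0 < c" "\<And>v. v \<in> {1..n} \<Longrightarrow> x v = c * z v"
proof -
  define y where "y v = x v / z v" for v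
  obtain i where i: "i \<in> {1..n}" "\<And>v. v \<in> {1..n} \<Longrightarrow> y v \<le> y i"
    using ex_arg_max[OF finite_atLeastAtMost vertices_nonempty, of y] by blast
  have const: "y v = y i" if "v \<in> {1..n}" for v
    using i(1) that
  proof (induction rule: adjacent_induct)
    case (step p q)
    then have p: "p \<in> {1..n}" using adjacent_vertices by blast
    have p_max: "\<forall>v. (u, v) \<in> adjacent E \<longrightarrow> y v \<le> y p" for u
      using i(2) step.IH adjacent_vertices by simp
    obtain j where j: "(p, j) \<in> adjacent E"
      and j_max: "\<forall>v. (p, v) \<in> adjacent E \<longrightarrow> y v \<le> y j"
      using maximal_neighbour[OF p, of y] by blast
    note max = p_max[unfolded y_def] j_max[unfolded y_def]
    have near_p: "y v = y j" if "(p, v) \<in> adjacent E" for v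
      unfolding y_def by (rule ratio_eq_if_b_prime_mult_le[OF x z j max le[OF j] that])
    have near_j: "y v = y p" if "(j, v) \<in> adjacent E" for v
      unfolding y_def
      by (rule ratio_eq_if_b_prime_mult_le[OF x z adjacent_sym[OF j] max(2,1)
            le[OF adjacent_sym[OF j]] that])
    obtain w where "(p, w) \<in> adjacent E" "(j, w) \<in> adjacent E"
      using common_neighbour[OF \<open>3 \<le> k\<close> j] .
    then have "y j = y p" using near_p near_j by metis
    then show ?case using near_p[OF step.hyps] step.IH by simp
  qed simp
  show ?thesis
  proof (rule that)
    show "0 < y i" using positiveD[OF x i(1)] positiveD[OF z i(1)] by (simp add: y_def)
    show "x v = y i * z v" if "v \<in> {1..n}" for v
      using const[OF that] positiveD[OF z that] by (simp add: y_def field_simps)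
  qed
qed

subsection \<open>The spectral radius\<close>

abbreviation spectral_radius :: real where
  "spectral_radius \<equiv> tensor_spectral_radius k n (signless_laplacian_tensor k E)"

lemma spectral_radius_eq_row_sum:
  assumes x: "positive x" and r: "\<forall>i\<in>{1..n}. row_sum x i = r"
  shows "spectral_radius = r"
  unfolding tensor_spectral_radius_def
proof (rule Greatest_equality)
  obtain i where i: "i \<in> {1..n}" using vertices_nonempty by blast
  have "0 \<le> r" using r i b_prime_pos[OF x i] by (force simp add: row_sum_def)
  then show "\<exists>lam. tensor_eigenvalue k n (signless_laplacian_tensor k E) lam \<and> r = cmod lam"
    using tensor_eigenvalue_if_row_sum_eq[OF x vertices_nonempty r]
    by (intro exI[of _ "of_real r"]) simp
  show "s \<le> r"
    if "\<exists>lam. tensor_eigenvalue k n (signless_laplacian_tensor k E) lam \<and> s = cmod lam" for s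
    using that cmod_eigenvalue_le[OF x] r by auto
qed

lemma perron_vector:
  obtains x where "positive x" "\<forall>i\<in>{1..n}. row_sum x i = spectral_radius"
proof -
  obtain r x where "0 \<le> r" and x: "rayleigh_maximiser r x" and "power_sum x = 1"
    using rayleigh_maximiser_exists[OF vertices_nonempty] .
  have "\<exists>u\<in>{1..n}. 0 < x u"
  proof (rule ccontr)
    assume "\<not> (\<exists>u\<in>{1..n}. 0 < x u)"
    then have "power_sum x = 0"
      using rayleigh_maximiserD(1)[OF x] k_pos
      by (auto simp: power_sum_def nonneg_def not_less intro!: sum.neutral dest!: antisym)
    with \<open>power_sum x = 1\<close> show False by simp
  qed
  then obtain u where u: "u \<in> {1..n}" "0 < x u" by blast
  have "0 < x v" if "v \<in> {1..n}" for v
    using u(1) that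
  proof (induction rule: adjacent_induct)
    case (step i j)
    then show ?case
      using rayleigh_maximiser_pos_on_edge[OF x \<open>0 \<le> r\<close>] by (auto simp: adjacent_iff)
  qed (rule u(2))
  then have "positive x" by (simp add: positive_def)
  moreover have "\<forall>i\<in>{1..n}. row_sum x i = r"
    using row_sum_rayleigh_maximiser[OF x] positiveD[OF \<open>positive x\<close>] by blast
  ultimately show ?thesis
    using that spectral_radius_eq_row_sum by blast
qed

lemma
  assumes x: "positive x" and r: "\<forall>i\<in>{1..n}. row_sum x i = r" and "(i, j) \<in> adjacent E"
  shows le_g_pair_iff:
      "r \<le> g_pair k E b i j \<longleftrightarrow> b_prime k E x i * b_prime k E x j \<le> b_prime k E b i * b_prime k E b j"
    and g_pair_le_iff:
      "g_pair k E b i j \<le> r \<longleftrightarrow> b_prime k E b i * b_prime k E b j \<le> b_prime k E x i * b_prime k E x j"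
proof -
  let ?d = "\<lambda>i. real (vertex_degree E i)"
  have gap: "r - ?d v = b_prime k E x v" "?d v \<le> r" if "v \<in> {1..n}" for v
    using bspec[OF r that] b_prime_pos[OF x that] by (simp_all add: row_sum_def)
  have "i \<in> {1..n}" "j \<in> {1..n}" using adjacent_vertices[OF assms(3)] by simp_all
  note gap = gap[OF this(1)] gap[OF this(2)]
  note root = le_larger_root_iff[OF gap(2,4), of "b_prime k E b i * b_prime k E b j"]
    larger_root_le_iff[OF gap(2,4), of "b_prime k E b i * b_prime k E b j"]
  show
    "r \<le> g_pair k E b i j \<longleftrightarrow> b_prime k E x i * b_prime k E x j \<le> b_prime k E b i * b_prime k E b j"
    "g_pair k E b i j \<le> r \<longleftrightarrow> b_prime k E b i * b_prime k E b j \<le> b_prime k E x i * b_prime k E x j"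
    using root unfolding gap g_pair_def mult.assoc .
qed

lemma exists_g_pair_le_spectral_radius:
  assumes "positive b"
  shows "\<exists>(i, j)\<in>adjacent E. g_pair k E b i j \<le> spectral_radius"
proof -
  obtain x where x: "positive x" "\<forall>i\<in>{1..n}. row_sum x i = spectral_radius"
    using perron_vector by blast
  obtain i j where "(i, j) \<in> adjacent E"
    "b_prime k E b i * b_prime k E b j \<le> b_prime k E x i * b_prime k E x j"
    using exists_b_prime_mult_le[OF assms x(1)] by blast
  then show ?thesis using g_pair_le_iff[OF x, of i j b] by blast
qed

lemma exists_g_pair_ge_spectral_radius:
  assumes "positive b"
  shows "\<exists>(i, j)\<in>adjacent E. spectral_radius \<le> g_pair k E b i j"
proof -
  obtain x where x: "positive x" "\<forall>i\<in>{1..n}. row_sum x i = spectral_radius"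
    using perron_vector by blast
  obtain i j where "(i, j) \<in> adjacent E"
    "b_prime k E x i * b_prime k E x j \<le> b_prime k E b i * b_prime k E b j"
    using exists_b_prime_mult_le[OF x(1) assms] by blast
  then show ?thesis using le_g_pair_iff[OF x, of i j b] by blast
qed

lemma row_sum_eq_spectral_radius:
  assumes "3 \<le> k" and b: "positive b"
    and g: "(\<forall>(i, j)\<in>adjacent E. g_pair k E b i j \<le> spectral_radius)
      \<or> (\<forall>(i, j)\<in>adjacent E. spectral_radius \<le> g_pair k E b i j)"
    and v: "v \<in> {1..n}"
  shows "row_sum b v = spectral_radius"
proof -
  obtain x where x: "positive x" "\<forall>i\<in>{1..n}. row_sum x i = spectral_radius"
    using perron_vector by blast
  have "b_prime k E b v = b_prime k E x v"
    using g
  proof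
    assume "\<forall>(i, j)\<in>adjacent E. g_pair k E b i j \<le> spectral_radius"
    then have "b_prime k E b i * b_prime k E b j \<le> b_prime k E x i * b_prime k E x j"
      if "(i, j) \<in> adjacent E" for i j
      using g_pair_le_iff[OF x that, of b] that by auto
    from proportional_if_b_prime_mult_le[OF \<open>3 \<le> k\<close> x(1) b this]
    obtain c where "0 < c" "\<And>v. v \<in> {1..n} \<Longrightarrow> x v = c * b v" by blast
    then show ?thesis using b_prime_proportional[of c x b v] v by simp
  next
    assume "\<forall>(i, j)\<in>adjacent E. spectral_radius \<le> g_pair k E b i j"
    then have "b_prime k E x i * b_prime k E x j \<le> b_prime k E b i * b_prime k E b j"
      if "(i, j) \<in> adjacent E" for i j
      using le_g_pair_iff[OF x that, of b] that by auto
    from proportional_if_b_prime_mult_le[OF \<open>3 \<le> k\<close> b x(1) this]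
    obtain c where "0 < c" "\<And>v. v \<in> {1..n} \<Longrightarrow> b v = c * x v" by blast
    then show ?thesis using b_prime_proportional[of c b x v] v by simp
  qed
  then show ?thesis using x(2) v by (auto simp: row_sum_def)
qed

lemma g_pair_eq_spectral_radius:
  assumes b: "positive b" and const: "\<forall>i\<in>{1..n}. \<forall>j\<in>{1..n}. row_sum b i = row_sum b j"
    and "(i, j) \<in> adjacent E"
  shows "g_pair k E b i j = spectral_radius"
proof -
  have "\<forall>v\<in>{1..n}. row_sum b v = spectral_radius"
    using spectral_radius_eq_row_sum[OF b] const by metis
  from le_g_pair_iff[OF b this assms(3), of b] g_pair_le_iff[OF b this assms(3), of b]
  show ?thesis by simp
qed

lemma MIN_vertex_pairs:
    "(MIN e\<in>E. MIN p\<in>vertex_pairs e. f p) = (MIN p\<in>adjacent E. f p :: 'b::linorder)"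
  and MAX_vertex_pairs:
    "(MAX e\<in>E. MAX p\<in>vertex_pairs e. f p) = (MAX p\<in>adjacent E. f p :: 'b::linorder)"
  unfolding adjacent_def image_UN
  by (subst Min.UN Max.UN; simp add: finite_edges nonempty finite_vertex_pairs vertex_pairs_nonempty)+

lemma
  assumes "positive b"
  shows MIN_g_pair_le_spectral_radius: "(MIN (i, j)\<in>adjacent E. g_pair k E b i j) \<le> spectral_radius"
    and spectral_radius_le_MAX_g_pair: "spectral_radius \<le> (MAX (i, j)\<in>adjacent E. g_pair k E b i j)"
proof -
  have "finite ((\<lambda>(i, j). g_pair k E b i j) ` adjacent E)"
    "(\<lambda>(i, j). g_pair k E b i j) ` adjacent E \<noteq> {}"
    using finite_adjacent adjacent_nonempty by auto
  note Min_le_iff[OF this] Max_ge_iff[OF this]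
  then show "(MIN (i, j)\<in>adjacent E. g_pair k E b i j) \<le> spectral_radius"
    and "spectral_radius \<le> (MAX (i, j)\<in>adjacent E. g_pair k E b i j)"
    using exists_g_pair_le_spectral_radius[OF assms] exists_g_pair_ge_spectral_radius[OF assms]
    by (simp_all add: case_prod_beta)
qed

lemma spectral_radius_eq_MIN_or_MAX_iff:
  assumes "3 \<le> k" and b: "positive b"
  shows "(MIN (i, j)\<in>adjacent E. g_pair k E b i j) = spectral_radius
      \<or> spectral_radius = (MAX (i, j)\<in>adjacent E. g_pair k E b i j)
    \<longleftrightarrow> (\<forall>i\<in>{1..n}. \<forall>j\<in>{1..n}. row_sum b i = row_sum b j)"
    (is "Min ?G = _ \<or> _ = Max ?G \<longleftrightarrow> ?const")
proof
  assume eq: "Min ?G = spectral_radius \<or> spectral_radius = Max ?G"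
  have "Min ?G \<le> g_pair k E b i j \<and> g_pair k E b i j \<le> Max ?G" if "(i, j) \<in> adjacent E" for i j
    using finite_adjacent that by (intro conjI Min_le Max_ge) force+
  then have "(\<forall>(i, j)\<in>adjacent E. g_pair k E b i j \<le> spectral_radius)
      \<or> (\<forall>(i, j)\<in>adjacent E. spectral_radius \<le> g_pair k E b i j)"
    using eq by fastforce
  then show ?const
    using row_sum_eq_spectral_radius[OF assms] by simp
next
  assume ?const
  then have "g_pair k E b i j = spectral_radius" if "(i, j) \<in> adjacent E" for i j
    using g_pair_eq_spectral_radius[OF b] that by blast
  then have "?G = {spectral_radius}" using adjacent_nonempty by force
  then show "Min ?G = spectral_radius \<or> spectral_radius = Max ?G" by simp
qed

end

theorem theorem3p6:
  fixes k n :: nat and E :: "nat set set" and b :: "nat \<Rightarrow> real"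
  assumes "k \<ge> 3"
    and "uniform_hypergraph k n E"
    and "connected_hypergraph n E"
    and "E \<noteq> {}"
    and "\<And>i. i \<in> {1..n} \<Longrightarrow> b i > 0"
  shows "(MIN e\<in>E. MIN (i, j)\<in>vertex_pairs e. g_pair k E b i j)
           \<le> tensor_spectral_radius k n (signless_laplacian_tensor k E)
       \<and> tensor_spectral_radius k n (signless_laplacian_tensor k E)
           \<le> (MAX e\<in>E. MAX (i, j)\<in>vertex_pairs e. g_pair k E b i j)
       \<and> ((MIN e\<in>E. MIN (i, j)\<in>vertex_pairs e. g_pair k E b i j)
             = tensor_spectral_radius k n (signless_laplacian_tensor k E)
           \<or> tensor_spectral_radius k n (signless_laplacian_tensor k E)
             = (MAX e\<in>E. MAX (i, j)\<in>vertex_pairs e. g_pair k E b i j)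
         \<longleftrightarrow> (\<forall>i\<in>{1..n}. \<forall>j\<in>{1..n}.
               real (vertex_degree E i) + b_prime k E b i = real (vertex_degree E j) + b_prime k E b j))"
proof -
  interpret connected_k_uniform_hypergraph k n E
    using assms by unfold_locales auto
  have "positive b" using assms(5) by (simp add: positive_def)
  then show ?thesis
    unfolding MIN_vertex_pairs MAX_vertex_pairs
    using MIN_g_pair_le_spectral_radius spectral_radius_le_MAX_g_pair
      spectral_radius_eq_MIN_or_MAX_iff[OF assms(1)]
    by (simp add: row_sum_def)
qed

end
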